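(* Let $a,b,c,d\in\mathbb{R}\setminus\{0\}$ be fixed numbers and $\mathcal{V}$ a real vector space. Consider, for a function $f:\mathbb{R}\to\mathcal{V}$, the equation $$f\big(\sqrt[3]{ax^3+by^3}\big)+f\big(\sqrt[3]{ax^3-by^3}\big)=cf(x)+df(y),\qquad x,y\in\mathbb{R}. \qquad (\mathrm{E})$$ (i) In the case $c+d\neq2$: $f$ satisfies (E) if and only if there exists a quadratic mapping $Q:\mathbb{R}\to\mathcal{V}$ such that $f(x)=Q(x^3)$ for all $x\in\mathbb{R}$ and $$Q(ax)=\frac{c}{2}Q(x),\qquad Q(bx)=\frac{d}{2}Q(x),\qquad x\in\mathbb{R}. \qquad (\mathrm{H})$$ (ii) In the case $c+d=2$: $f$ satisfies (E) if and only if there exist $w\in\mathcal{V}$ and a quadratic mapping $Q:\mathbb{R}\to\mathcal{V}$ such that (H) holds and $f(x)=Q(x^3)+w$ for all $x\in\mathbb{R}$.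
   Context: $\sqrt[3]{\cdot}$ is the real cube root. A mapping $Q:\mathbb{R}\to\mathcal{V}$ is quadratic if $Q(x+y)+Q(x-y)=2Q(x)+2Q(y)$ for all $x,y\in\mathbb{R}$. *)

theory Defs
  imports Complex_Main
begin

definition quadratic_map :: "(real \<Rightarrow> 'v::real_vector) \<Rightarrow> bool" where
  "quadratic_map Q \<longleftrightarrow> (\<forall>x y. Q (x + y) + Q (x - y) = 2 *\<^sub>R Q x + 2 *\<^sub>R Q y)"

text \<open>\<^term>\<open>root 3\<close> is the real cube root on all reals; it is odd, so negative arguments are unproblematic.\<close>

definition cubic_root_equation ::
  "real \<Rightarrow> real \<Rightarrow> real \<Rightarrow> real \<Rightarrow> (real \<Rightarrow> 'v::real_vector) \<Rightarrow> bool" where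
  "cubic_root_equation a b c d f \<longleftrightarrow>
     (\<forall>x y. f (root 3 (a * x ^ 3 + b * y ^ 3)) + f (root 3 (a * x ^ 3 - b * y ^ 3))
            = c *\<^sub>R f x + d *\<^sub>R f y)"

definition homogeneity_conditions ::
  "real \<Rightarrow> real \<Rightarrow> real \<Rightarrow> real \<Rightarrow> (real \<Rightarrow> 'v::real_vector) \<Rightarrow> bool" where
  "homogeneity_conditions a b c d Q \<longleftrightarrow>
     (\<forall>x. Q (a * x) = (c / 2) *\<^sub>R Q x) \<and> (\<forall>x. Q (b * x) = (d / 2) *\<^sub>R Q x)"

end

theory Submission
  imports Defs
begin

text \<open>The substitution \<open>g u = f (root 3 u)\<close> turns the equation into
  \<open>g (a u + b v) + g (a u - b v) = c g u + d g v\<close>. Replacing \<open>v\<close> by \<open>-v\<close> shows that \<open>g\<close> is even.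
  If moreover \<open>g 0 = 0\<close>, then setting \<open>v = 0\<close> or \<open>u = 0\<close> gives \<open>2 g (a u) = c g u\<close> and
  \<open>2 g (b v) = d g v\<close>, so the right-hand side is \<open>2 g (a u) + 2 g (b v)\<close> and \<open>g\<close> is quadratic.
  Setting \<open>u = v = 0\<close> forces \<open>g 0 = 0\<close> unless \<open>c + d = 2\<close>, in which case constants solve
  the equation and \<open>g 0\<close> can be subtracted.\<close>

lemma root_3_cube [simp]: "root 3 (x ^ 3) = x"
  by (simp add: odd_real_root_power_cancel)

lemma cube_root_3 [simp]: "root 3 x ^ 3 = x"
  by (simp add: odd_real_root_pow)

text \<open>Cubing is a bijection of the reals with inverse \<open>root 3\<close>, so
  \<open>x ^ 3\<close> and \<open>y ^ 3\<close> range over arbitrary reals \<open>u\<close> and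
  \<open>v\<close>.\<close>

lemma cubic_root_equation_iff:
  "cubic_root_equation a b c d f \<longleftrightarrow>
    (\<forall>u v. f (root 3 (a * u + b * v)) + f (root 3 (a * u - b * v))
           = c *\<^sub>R f (root 3 u) + d *\<^sub>R f (root 3 v))"
  unfolding cubic_root_equation_def by (metis root_3_cube cube_root_3)

lemma double_eq_scaleR_iff:
  fixes x y :: "'v::real_vector"
  shows "x + x = c *\<^sub>R y \<longleftrightarrow> x = (c / 2) *\<^sub>R y"
proof -
  have "x + x = c *\<^sub>R y \<longleftrightarrow> 2 *\<^sub>R x = 2 *\<^sub>R ((c / 2) *\<^sub>R y)"
    by (simp add: scaleR_2)
  also have "\<dots> \<longleftrightarrow> x = (c / 2) *\<^sub>R y"
    by (subst scaleR_cancel_left) simp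
  finally show ?thesis .
qed

lemma quadratic_homogeneous_if_linear_equation:
  fixes g :: "real \<Rightarrow> 'v::real_vector"
  assumes "a \<noteq> 0" "b \<noteq> 0" "d \<noteq> 0" and zero: "g 0 = 0"
    and eq: "\<And>u v. g (a * u + b * v) + g (a * u - b * v) = c *\<^sub>R g u + d *\<^sub>R g v"
  shows "quadratic_map g" and "homogeneity_conditions a b c d g"
proof -
  \<comment> \<open>At \<open>u = 0\<close> the left-hand side is symmetric in \<open>v\<close> and
    \<open>- v\<close>; cancel \<open>d\<close>.\<close>
  have even: "g (- v) = g v" for v
    using eq[of 0 v] eq[of 0 "- v"] \<open>d \<noteq> 0\<close> by (simp add: zero add.commute)
  have ga: "g (a * u) + g (a * u) = c *\<^sub>R g u" for u
    using eq[of u 0] by (simp add: zero)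
  have gb: "g (b * v) + g (b * v) = d *\<^sub>R g v" for v
    using eq[of 0 v] by (simp add: zero even)
  show "homogeneity_conditions a b c d g"
    using ga gb by (simp add: homogeneity_conditions_def double_eq_scaleR_iff)
  show "quadratic_map g"
    unfolding quadratic_map_def
  proof (intro allI)
    fix x y
    \<comment> \<open>Dividing by \<open>a\<close> and \<open>b\<close> turns the arguments into
      \<open>x + y\<close> and \<open>x - y\<close>; then \<open>ga\<close> and \<open>gb\<close>
      absorb the coefficients \<open>c\<close> and \<open>d\<close>.\<close>
    show "g (x + y) + g (x - y) = 2 *\<^sub>R g x + 2 *\<^sub>R g y"
      using eq[of "x / a" "y / b"] ga[of "x / a"] gb[of "y / b"] \<open>a \<noteq> 0\<close> \<open>b \<noteq> 0\<close>
      by (simp add: scaleR_2)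
  qed
qed

text \<open>The condition on \<open>w\<close> says that the constant function \<open>w\<close>
  solves the equation. It covers both cases of the theorem: \<open>w = 0\<close> always qualifies,
  and every \<open>w\<close> does if \<open>c + d = 2\<close>.\<close>

lemma cubic_root_equation_if_quadratic:
  fixes f :: "real \<Rightarrow> 'v::real_vector"
  assumes quad: "quadratic_map Q" and hom: "homogeneity_conditions a b c d Q"
    and f: "\<And>x. f x = Q (x ^ 3) + w" and w: "(c + d) *\<^sub>R w = 2 *\<^sub>R w"
  shows "cubic_root_equation a b c d f"
  unfolding cubic_root_equation_iff
proof (intro allI)
  fix u v
  have "Q (a * u + b * v) + Q (a * u - b * v) = 2 *\<^sub>R Q (a * u) + 2 *\<^sub>R Q (b * v)"
    using quad by (simp add: quadratic_map_def)
  also have "\<dots> = c *\<^sub>R Q u + d *\<^sub>R Q v"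
    using hom by (simp add: homogeneity_conditions_def)
  finally have "Q (a * u + b * v) + Q (a * u - b * v) + 2 *\<^sub>R w
      = c *\<^sub>R Q u + d *\<^sub>R Q v + (c + d) *\<^sub>R w"
    by (simp add: w)
  then show "f (root 3 (a * u + b * v)) + f (root 3 (a * u - b * v))
      = c *\<^sub>R f (root 3 u) + d *\<^sub>R f (root 3 v)"
    by (simp add: f scaleR_2 scaleR_add_left scaleR_add_right add_ac)
qed

lemma quadratic_if_cubic_root_equation:
  fixes f :: "real \<Rightarrow> 'v::real_vector"
  assumes "a \<noteq> 0" "b \<noteq> 0" "d \<noteq> 0" and sol: "cubic_root_equation a b c d f"
  obtains Q where "quadratic_map Q" "homogeneity_conditions a b c d Q"
    "\<And>x. f x = Q (x ^ 3) + f 0" "(c + d) *\<^sub>R f 0 = 2 *\<^sub>R f 0"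
proof -
  \<comment> \<open>Subtracting \<open>f 0\<close> gives the normalisation
    \<open>Q 0 = 0\<close>.\<close>
  define Q where "Q u = f (root 3 u) - f 0" for u
  have eq: "f (root 3 (a * u + b * v)) + f (root 3 (a * u - b * v))
      = c *\<^sub>R f (root 3 u) + d *\<^sub>R f (root 3 v)" for u v
    using sol unfolding cubic_root_equation_iff by blast
  have w: "c *\<^sub>R f 0 + d *\<^sub>R f 0 = f 0 + f 0"
    using eq[of 0 0] by simp
  have Q0: "Q 0 = 0"
    by (simp add: Q_def)
  have Qeq: "Q (a * u + b * v) + Q (a * u - b * v) = c *\<^sub>R Q u + d *\<^sub>R Q v" for u v
  proof -
    have "Q (a * u + b * v) + Q (a * u - b * v)
        = c *\<^sub>R f (root 3 u) + d *\<^sub>R f (root 3 v) - (f 0 + f 0)"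
      unfolding eq[symmetric] by (simp add: Q_def)
    \<comment> \<open>By \<open>w\<close>, the subtracted constant splits into a \<open>c\<close>
      part and a \<open>d\<close> part, one for each term.\<close>
    also have "\<dots> = c *\<^sub>R Q u + d *\<^sub>R Q v"
      unfolding w[symmetric] by (simp add: Q_def scaleR_diff_right)
    finally show ?thesis .
  qed
  show thesis
  proof
    show "quadratic_map Q" "homogeneity_conditions a b c d Q"
      using quadratic_homogeneous_if_linear_equation[OF assms(1-3) Q0 Qeq] by auto
    show "f x = Q (x ^ 3) + f 0" for x
      by (simp add: Q_def)
    show "(c + d) *\<^sub>R f 0 = 2 *\<^sub>R f 0"
      using w by (simp add: scaleR_add_left scaleR_2)
  qed
qed

theorem theorem4p2:
  fixes a b c d :: real and f :: "real \<Rightarrow> 'v::real_vector"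
  assumes "a \<noteq> 0" and "b \<noteq> 0" and "c \<noteq> 0" and "d \<noteq> 0"
  shows "(c + d \<noteq> 2 \<longrightarrow>
            (cubic_root_equation a b c d f \<longleftrightarrow>
              (\<exists>Q. quadratic_map Q \<and> (\<forall>x. f x = Q (x ^ 3)) \<and>
                   homogeneity_conditions a b c d Q)))
       \<and> (c + d = 2 \<longrightarrow>
            (cubic_root_equation a b c d f \<longleftrightarrow>
              (\<exists>w Q. quadratic_map Q \<and> homogeneity_conditions a b c d Q \<and>
                     (\<forall>x. f x = Q (x ^ 3) + w))))"
proof (intro conjI impI)
  assume "c + d \<noteq> 2"
  \<comment> \<open>The hypothesis on \<open>w\<close> amounts to
    \<open>(c + d - 2) *\<^sub>R w = 0\<close> with a nonzero scalar.\<close>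
  then have zero: "w = 0" if "(c + d) *\<^sub>R w = 2 *\<^sub>R w" for w :: 'v
    using that scaleR_cancel_right by blast
  show "cubic_root_equation a b c d f \<longleftrightarrow>
      (\<exists>Q. quadratic_map Q \<and> (\<forall>x. f x = Q (x ^ 3)) \<and> homogeneity_conditions a b c d Q)"
  proof
    assume "cubic_root_equation a b c d f"
    then obtain Q where "quadratic_map Q" "homogeneity_conditions a b c d Q"
      "\<And>x. f x = Q (x ^ 3) + f 0" "(c + d) *\<^sub>R f 0 = 2 *\<^sub>R f 0"
      using quadratic_if_cubic_root_equation assms by metis
    then show "\<exists>Q. quadratic_map Q \<and> (\<forall>x. f x = Q (x ^ 3)) \<and> homogeneity_conditions a b c d Q"
      using zero by (metis add.right_neutral)
  next
    assume "\<exists>Q. quadratic_map Q \<and> (\<forall>x. f x = Q (x ^ 3)) \<and> homogeneity_conditions a b c d Q"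
    then show "cubic_root_equation a b c d f"
      by (auto intro: cubic_root_equation_if_quadratic[where w = 0])
  qed
next
  assume "c + d = 2"
  then show "cubic_root_equation a b c d f \<longleftrightarrow>
      (\<exists>w Q. quadratic_map Q \<and> homogeneity_conditions a b c d Q \<and> (\<forall>x. f x = Q (x ^ 3) + w))"
    \<comment> \<open>Here the condition on the constant holds trivially; the forward direction
      takes \<open>w = f 0\<close>.\<close>
    using quadratic_if_cubic_root_equation[OF assms(1,2,4)] cubic_root_equation_if_quadratic
    by metis
qed

end
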